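(* Let $P$ be a partially ordered pattern (a partial order on $\{1,\ldots,k\}$) that is bipartite, i.e. contains no chain of three elements. Then the permutation class $\operatorname{Av}(P)$ has a regular insertion encoding.
   Context: A permutation $\pi$ of size $n$ contains the POP $P$ if there are indices $i_1<i_2<\cdots<i_k$ such that $\pi(i_a)<\pi(i_b)$ whenever $a<_P b$; $\operatorname{Av}(P)$ is the set of all permutations (of all sizes) avoiding $P$. Insertion encoding: a permutation of size $n$ is built by inserting the values $1,2,\ldots,n$ in increasing order into a configuration, a word over the symbols $\bullet$ (placed entry) and $\diamond$ (slot), starting from the single slot $\diamond$. At step $j$ the value $j$ is inserted into the $i$-th slot from the left by one of four operations: $f_i$ replaces that slot by $\bullet$, $l_i$ by $\bullet\diamond$, $r_i$ by $\diamond\bullet$, $m_i$ by $\diamond\bullet\diamond$; after $n$ steps no slots remain and the left-to-right sequence of inserted values is the permutation. Every permutation has a unique such encoding as a word over the letters $\{f_i,l_i,r_i,m_i : i\ge 1\}$. A permutation class has a regular insertion encoding if the set of encodings of its members is a regular language over a finite alphabet. *)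

theory Defs
  imports "HOL-Combinatorics.Multiset_Permutations"
begin

text \<open>
  A pattern of size \<open>k\<close> is a (reflexive) partial order \<open>P\<close> on \<open>{1..k}\<close>. A permutation of size
  \<open>n\<close> is the list of its values, so the entry at position \<open>i\<close> is \<open>\<pi> ! (i - 1)\<close>.
\<close>

definition bipartite_pop :: "nat rel \<Rightarrow> bool" where
  "bipartite_pop P \<longleftrightarrow> \<not> (\<exists>C \<in> Chains P. card C = 3)"

definition contains_pop :: "nat \<Rightarrow> nat rel \<Rightarrow> nat list \<Rightarrow> bool" where
  "contains_pop k P \<pi> \<longleftrightarrow>
     (\<exists>i. strict_mono_on {1..k} i \<and> i ` {1..k} \<subseteq> {1..length \<pi>} \<and>
          (\<forall>a\<in>{1..k}. \<forall>b\<in>{1..k}. (a, b) \<in> P \<and> a \<noteq> b \<longrightarrow> \<pi> ! (i a - 1) < \<pi> ! (i b - 1)))"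

definition Av :: "nat \<Rightarrow> nat rel \<Rightarrow> nat list set" where
  "Av k P = {\<pi>. (\<exists>n. \<pi> \<in> permutations_of_set {1..n}) \<and> \<not> contains_pop k P \<pi>}"

text \<open>
  Every placed entry of a configuration is labelled with its value, so that the permutation can
  be read off a configuration without slots.
\<close>

datatype symbol = Slot | Entry nat

datatype operation = Fill | Leftmost | Rightmost | Middle

text \<open>
  \<open>(Fill, i)\<close>, \<open>(Leftmost, i)\<close>, \<open>(Rightmost, i)\<close>, \<open>(Middle, i)\<close> stand for the letters
  \<open>f\<close>, \<open>l\<close>, \<open>r\<close>, \<open>m\<close> with index \<open>i\<close>.
\<close>

type_synonym letter = "operation \<times> nat"

fun replacement :: "operation \<Rightarrow> nat \<Rightarrow> symbol list" where
  "replacement Fill j = [Entry j]"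
| "replacement Leftmost j = [Entry j, Slot]"
| "replacement Rightmost j = [Slot, Entry j]"
| "replacement Middle j = [Slot, Entry j, Slot]"

definition insertion :: "nat \<Rightarrow> letter \<Rightarrow> symbol list \<Rightarrow> symbol list \<Rightarrow> bool" where
  "insertion j x c c' \<longleftrightarrow>
     (\<exists>us vs. c = us @ Slot # vs \<and> snd x = count_list us Slot + 1 \<and>
              c' = us @ replacement (fst x) j @ vs)"

inductive builds :: "letter list \<Rightarrow> symbol list \<Rightarrow> bool" where
  start: "builds [] [Slot]"
| step: "builds w c \<Longrightarrow> insertion (length w + 1) x c c' \<Longrightarrow> builds (w @ [x]) c'"

text \<open>
  The empty permutation has no encoding, since the initial configuration contains a slot.
\<close>

definition encodes :: "letter list \<Rightarrow> nat list \<Rightarrow> bool" where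
  "encodes w \<pi> \<longleftrightarrow> builds w (map Entry \<pi>)"

definition encodings :: "nat list set \<Rightarrow> letter list set" where
  "encodings C = {w. \<exists>\<pi>\<in>C. encodes w \<pi>}"

text \<open>
  Acceptance by a complete deterministic finite automaton over the alphabet \<open>\<Sigma>\<close>; taking natural
  numbers as states loses no generality.
\<close>

definition regular_language :: "'a set \<Rightarrow> 'a list set \<Rightarrow> bool" where
  "regular_language \<Sigma> L \<longleftrightarrow>
     (\<exists>(Q :: nat set) q0 \<delta> F.
        finite Q \<and> q0 \<in> Q \<and> F \<subseteq> Q \<and> (\<forall>q\<in>Q. \<forall>a\<in>\<Sigma>. \<delta> q a \<in> Q) \<and>
        L = {w \<in> lists \<Sigma>. foldl \<delta> q0 w \<in> F})"

definition has_regular_insertion_encoding :: "nat list set \<Rightarrow> bool" where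
  "has_regular_insertion_encoding C \<longleftrightarrow>
     (\<exists>\<Sigma>. finite \<Sigma> \<and> regular_language \<Sigma> (encodings C))"

end

theory Submission
  imports Defs "HOL-Library.Sublist"
begin

text \<open>
  Two slots are never adjacent, and every slot eventually receives an entry larger than all entries
  already placed. A configuration with more than \<open>k\<close> slots therefore forces an alternation
  large, small, large, small, ... in which every word of length \<open>k\<close> over large and small occurs;
  sending the elements of \<open>P\<close> that have a strict predecessor to large entries and all others to
  small ones embeds \<open>P\<close>, as \<open>P\<close> has no chain of three elements. So at most \<open>k\<close> slots occur while
  building a permutation that avoids \<open>P\<close>.

  Since values are inserted in increasing order, the elements of \<open>P\<close> placed so far by an embedding
  form a down-set, and all that matters for completing the embedding is how these elements are
  interleaved with the slots. The set of interleavings that can be realised in a configuration takes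
  finitely many values as long as the number of slots is bounded, and its change under an insertion
  depends only on the letter: it is the state of a deterministic automaton.
\<close>

section \<open>Regular languages\<close>

lemma regular_language_state_map:
  fixes f :: "'a list \<Rightarrow> 'q"
  assumes finite: "finite (f ` lists \<Sigma>)"
    and step: "\<And>w x. w \<in> lists \<Sigma> \<Longrightarrow> x \<in> \<Sigma> \<Longrightarrow> f (w @ [x]) = \<delta> (f w) x"
  shows "regular_language \<Sigma> {w \<in> lists \<Sigma>. f w \<in> F}"
proof -
  let ?Q = "f ` lists \<Sigma>"
  obtain h :: "'q \<Rightarrow> nat" where inj: "inj_on h ?Q"
    using finite_imp_inj_to_nat_seg[OF finite] by blast
  define \<delta>' where "\<delta>' n x = h (\<delta> (inv_into ?Q h n) x)" for n x
  have \<delta>'_h: "\<delta>' (h (f w)) x = h (f (w @ [x]))" if "w \<in> lists \<Sigma>" "x \<in> \<Sigma>" for w x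
    using that step by (simp add: \<delta>'_def inv_into_f_f[OF inj])
  have run: "foldl \<delta>' (h (f [])) w = h (f w)" if "w \<in> lists \<Sigma>" for w
    using that by (induction w rule: rev_induct) (simp_all add: \<delta>'_h)
  have closed: "\<delta>' n x \<in> h ` ?Q" if "n \<in> h ` ?Q" "x \<in> \<Sigma>" for n x
  proof -
    from that(1) obtain w where "w \<in> lists \<Sigma>" "n = h (f w)" by blast
    with that(2) show ?thesis by (auto simp: \<delta>'_h intro!: imageI)
  qed
  have "foldl \<delta>' (h (f [])) w \<in> h ` (F \<inter> ?Q) \<longleftrightarrow> f w \<in> F" if "w \<in> lists \<Sigma>" for w
    using that run inj_on_image_mem_iff[OF inj, of "f w" "F \<inter> ?Q"] by simp
  then have "{w \<in> lists \<Sigma>. f w \<in> F} = {w \<in> lists \<Sigma>. foldl \<delta>' (h (f [])) w \<in> h ` (F \<inter> ?Q)}"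
    by blast
  then show ?thesis
    unfolding regular_language_def using finite closed
    by (intro exI[of _ "h ` ?Q"] exI[of _ "h (f [])"] exI[of _ \<delta>'] exI[of _ "h ` (F \<inter> ?Q)"]) auto
qed


section \<open>Subsequences\<close>

lemma subseq_map_conv: "subseq xs (map f ys) \<longleftrightarrow> (\<exists>zs. subseq zs ys \<and> xs = map f zs)"
  by (auto simp: subseq_conv_nths nths_map)

lemma subseq_conv_sorted_indices:
  "subseq xs ys \<longleftrightarrow>
     (\<exists>js. sorted_wrt (<) js \<and> set js \<subseteq> {..<length ys} \<and> xs = map (nth ys) js)"
proof -
  have "subseq js [0..<n] \<longleftrightarrow> sorted_wrt (<) js \<and> set js \<subseteq> {..<n}" for js n
  proof
    assume "subseq js [0..<n]"
    then show "sorted_wrt (<) js \<and> set js \<subseteq> {..<n}"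
      by (auto simp: subseq_conv_nths strict_sorted_iff sorted_nths dest: in_set_nthsD)
  next
    assume "sorted_wrt (<) js \<and> set js \<subseteq> {..<n}"
    then show "subseq js [0..<n]"
      by (intro sorted_subset_imp_subseq) (auto simp: atLeast_upt)
  qed
  then show ?thesis
    using subseq_map_conv[of xs "nth ys" "[0..<length ys]"] by (auto simp: map_nth)
qed

lemma subseq_concat_replicate:
  "set xs \<subseteq> set ys \<Longrightarrow> subseq xs (concat (replicate (length xs) ys))"
proof (induction xs)
  case (Cons x xs)
  then have "subseq ([x] @ xs) (ys @ concat (replicate (length xs) ys))"
    by (intro list_emb_append_mono) (auto simp: subseq_singleton_left)
  then show ?case by simp
qed simp

lemma subseq_alternating_if_no_adjacent_True:
  assumes "successively (\<lambda>x y. \<not> (x \<and> y)) bs" "n < count_list bs True"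
  shows "subseq (concat (replicate n [True, False])) bs"
  using assms
proof (induction bs arbitrary: n rule: induct_list012)
  case (2 x)
  then show ?case by (cases n) (auto split: if_splits)
next
  case (3 x y bs)
  show ?case
  proof (cases "x \<and> n \<noteq> 0")
    case True
    then obtain m where "n = Suc m" by (cases n) auto
    with True 3 show ?thesis by (cases bs) (auto simp: successively_Cons)
  next
    case False
    then show ?thesis using 3 by (cases "n = 0") auto
  qed
qed auto

lemma map_filter_map_of_zip:
  assumes "subseq xs ys" "distinct ys" "length xs = length zs"
  shows "List.map_filter (map_of (zip xs zs)) ys = zs"
proof -
  from assms have xs: "distinct xs" "filter (\<lambda>y. y \<in> set xs) ys = xs"
    by (auto simp: subseq_conv_nths filter_in_nths)
  have "List.map_filter (map_of (zip xs zs)) ys = map (the \<circ> map_of (zip xs zs)) xs"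
    using xs(2) assms(3) by (simp add: List.map_filter_def)
  also have "\<dots> = zs"
    using xs(1) assms(3) by (intro nth_equalityI) (auto simp: map_of_zip_nth)
  finally show ?thesis .
qed


section \<open>Occurrences of a pattern\<close>

definition predecessors :: "'a rel \<Rightarrow> 'a \<Rightarrow> 'a set" where
  "predecessors P b = {a. (a, b) \<in> P \<and> a \<noteq> b}"

definition pop_instance :: "nat \<Rightarrow> nat rel \<Rightarrow> nat list \<Rightarrow> bool" where
  "pop_instance k P \<sigma> \<longleftrightarrow> length \<sigma> = k \<and>
     (\<forall>a\<in>{1..k}. \<forall>b\<in>{1..k}. a \<in> predecessors P b \<longrightarrow> \<sigma> ! (a - 1) < \<sigma> ! (b - 1))"

lemma contains_pop_imp_subseq:
  assumes "contains_pop k P \<pi>"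
  shows "\<exists>\<sigma>. subseq \<sigma> \<pi> \<and> pop_instance k P \<sigma>"
proof -
  from assms obtain i where i: "strict_mono_on {1..k} i" "i ` {1..k} \<subseteq> {1..length \<pi>}"
    and less: "\<forall>a\<in>{1..k}. \<forall>b\<in>{1..k}. (a, b) \<in> P \<and> a \<noteq> b \<longrightarrow> \<pi> ! (i a - 1) < \<pi> ! (i b - 1)"
    unfolding contains_pop_def by blast
  define js where "js = map (\<lambda>a. i (Suc a) - 1) [0..<k]"
  have pos: "i a \<in> {1..length \<pi>}" if "a \<in> {1..k}" for a
    using i(2) that by blast
  have "sorted_wrt (<) js"
    unfolding sorted_wrt_iff_nth_less
  proof (intro allI impI)
    fix p q assume "p < q" "q < length js"
    then show "js ! p < js ! q"
      using pos[of "Suc p"] strict_mono_onD[OF i(1), of "Suc p" "Suc q"] by (auto simp: js_def)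
  qed
  moreover have "set js \<subseteq> {..<length \<pi>}"
  proof
    fix p assume "p \<in> set js"
    then obtain a where "a < k" "p = i (Suc a) - 1" by (auto simp: js_def)
    then show "p \<in> {..<length \<pi>}" using pos[of "Suc a"] by auto
  qed
  ultimately have "subseq (map (nth \<pi>) js) \<pi>"
    unfolding subseq_conv_sorted_indices by blast
  moreover have "pop_instance k P (map (nth \<pi>) js)"
    using less by (auto simp: pop_instance_def predecessors_def js_def)
  ultimately show "\<exists>\<sigma>. subseq \<sigma> \<pi> \<and> pop_instance k P \<sigma>" by blast
qed

lemma contains_pop_if_subseq:
  assumes "subseq \<sigma> \<pi>" "pop_instance k P \<sigma>"
  shows "contains_pop k P \<pi>"
proof -
  from assms obtain js where js: "sorted_wrt (<) js" "set js \<subseteq> {..<length \<pi>}"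
    and inst: "pop_instance k P (map (nth \<pi>) js)"
    unfolding subseq_conv_sorted_indices by blast
  then have len: "length js = k" by (simp add: pop_instance_def)
  have nth_js: "map (nth \<pi>) js ! (a - 1) = \<pi> ! (js ! (a - 1))" if "a \<in> {1..k}" for a
    using that len by (intro nth_map) auto
  show "contains_pop k P \<pi>"
    unfolding contains_pop_def
  proof (intro exI[of _ "\<lambda>a. Suc (js ! (a - 1))"] conjI)
    show "strict_mono_on {1..k} (\<lambda>a. Suc (js ! (a - 1)))"
      using sorted_wrt_nth_less[OF js(1)] len by (auto intro!: strict_mono_onI)
    show "(\<lambda>a. Suc (js ! (a - 1))) ` {1..k} \<subseteq> {1..length \<pi>}"
      using js(2) len by (auto simp: subset_iff Suc_le_eq)
    show "\<forall>a\<in>{1..k}. \<forall>b\<in>{1..k}. (a, b) \<in> P \<and> a \<noteq> b \<longrightarrow>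
        \<pi> ! (Suc (js ! (a - 1)) - 1) < \<pi> ! (Suc (js ! (b - 1)) - 1)"
      using inst nth_js by (simp add: pop_instance_def predecessors_def)
  qed
qed

lemma bipartite_pop_predecessors_empty:
  assumes "partial_order_on A P" "bipartite_pop P" "b \<in> predecessors P c"
  shows "predecessors P b = {}"
proof (rule ccontr)
  assume "predecessors P b \<noteq> {}"
  then obtain a where ab: "(a, b) \<in> P" "a \<noteq> b" by (auto simp: predecessors_def)
  have bc: "(b, c) \<in> P" "b \<noteq> c" using assms(3) by (auto simp: predecessors_def)
  have po: "refl_on A P" "trans P" "antisym P" "P \<subseteq> A \<times> A"
    using assms(1) by (auto simp: order_on_defs)
  have "a \<noteq> c" using ab bc po(3) by (auto dest: antisymD)
  then have "card {a, b, c} = 3" using ab bc by simp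
  moreover have "{a, b, c} \<in> Chains P"
    using ab bc po by (auto simp: Chains_def refl_on_def dest: transD)
  ultimately show False using assms(2) unfolding bipartite_pop_def by blast
qed

lemma contains_pop_if_subseq_threshold:
  assumes "partial_order_on {1..k} P" "bipartite_pop P"
    and "subseq (map (\<lambda>b. predecessors P b \<noteq> {}) [1..<Suc k]) (map (\<lambda>v. j < v) \<pi>)"
  shows "contains_pop k P \<pi>"
proof -
  from assms(3) obtain \<sigma> where \<sigma>: "subseq \<sigma> \<pi>"
    "map (\<lambda>b. predecessors P b \<noteq> {}) [1..<Suc k] = map (\<lambda>v. j < v) \<sigma>"
    unfolding subseq_map_conv by blast
  have len: "length \<sigma> = k" using arg_cong[OF \<sigma>(2), of length] by (simp del: upt_Suc)
  have above: "j < \<sigma> ! (b - 1) \<longleftrightarrow> predecessors P b \<noteq> {}" if "b \<in> {1..k}" for b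
    using arg_cong[OF \<sigma>(2), of "\<lambda>bs. bs ! (b - 1)"] that len by (auto simp del: upt_Suc)
  have "\<sigma> ! (a - 1) < \<sigma> ! (b - 1)" if "a \<in> {1..k}" "b \<in> {1..k}" "a \<in> predecessors P b" for a b
  proof -
    have "\<not> j < \<sigma> ! (a - 1)"
      using above[OF that(1)] bipartite_pop_predecessors_empty[OF assms(1,2) that(3)] by simp
    moreover have "j < \<sigma> ! (b - 1)"
      using above[OF that(2)] that(3) by blast
    ultimately show ?thesis by linarith
  qed
  with len have "pop_instance k P \<sigma>" by (simp add: pop_instance_def)
  with \<sigma>(1) show ?thesis by (rule contains_pop_if_subseq)
qed


section \<open>Configurations and insertions\<close>

fun entries :: "symbol list \<Rightarrow> nat list" where
  "entries [] = []"
| "entries (Slot # c) = entries c"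
| "entries (Entry v # c) = v # entries c"

lemma entries_append [simp]: "entries (c @ d) = entries c @ entries d"
  by (induction c rule: entries.induct) auto

lemma entries_map_Entry [simp]: "entries (map Entry \<pi>) = \<pi>"
  by (induction \<pi>) auto

lemma entries_replacement [simp]: "entries (replacement op j) = [j]"
  by (cases op) auto

lemma set_subset_Slot_entries: "set c \<subseteq> insert Slot (Entry ` set (entries c))"
  by (induction c rule: entries.induct) auto

lemma Slot_notin_set_iff: "Slot \<notin> set c \<longleftrightarrow> (\<exists>\<pi>. c = map Entry \<pi>)"
  unfolding ex_map_conv by (metis symbol.distinct(1) symbol.exhaust)

lemma length_eq_count_Slot_entries: "length c = count_list c Slot + length (entries c)"
  by (induction c rule: entries.induct) auto

definition splits_at_slot :: "nat \<Rightarrow> symbol list \<Rightarrow> symbol list \<Rightarrow> symbol list \<Rightarrow> bool" where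
  "splits_at_slot i c us vs \<longleftrightarrow> c = us @ Slot # vs \<and> i = count_list us Slot + 1"

lemma splits_at_slot_unique:
  assumes "splits_at_slot i c us vs" "splits_at_slot i c us' vs'"
  shows "us = us' \<and> vs = vs'"
proof -
  have "us @ Slot # vs = us' @ Slot # vs'" "count_list us Slot = count_list us' Slot"
    using assms by (auto simp: splits_at_slot_def)
  then show ?thesis
  proof (induction us arbitrary: us')
    case Nil
    then show ?case by (cases us') auto
  next
    case (Cons s us)
    then show ?case by (cases us') (auto split: if_splits)
  qed
qed

lemma ex_splits_at_slot_iff:
  "(\<exists>us vs. splits_at_slot i c us vs) \<longleftrightarrow> i \<in> {1..count_list c Slot}"
proof
  assume "i \<in> {1..count_list c Slot}"
  then show "\<exists>us vs. splits_at_slot i c us vs"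
  proof (induction c arbitrary: i)
    case (Cons s c)
    consider "s = Slot" "i = 1" | "s = Slot" "i - 1 \<in> {1..count_list c Slot}"
      | "s \<noteq> Slot" "i \<in> {1..count_list c Slot}"
      using Cons.prems by (cases "s = Slot"; cases "i = 1") fastforce+
    then show ?case
    proof cases
      case 1
      then have "splits_at_slot i (s # c) [] c" by (simp add: splits_at_slot_def)
      then show ?thesis by blast
    next
      case 2
      with Cons.IH obtain us vs where "splits_at_slot (i - 1) c us vs" by blast
      with 2 have "splits_at_slot i (s # c) (s # us) vs" by (auto simp: splits_at_slot_def)
      then show ?thesis by blast
    next
      case 3
      with Cons.IH obtain us vs where "splits_at_slot i c us vs" by blast
      with 3 have "splits_at_slot i (s # c) (s # us) vs" by (auto simp: splits_at_slot_def)
      then show ?thesis by blast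
    qed
  qed simp
qed (auto simp: splits_at_slot_def)

lemma insertion_iff_splits_at_slot:
  "insertion j x c c' \<longleftrightarrow>
     (\<exists>us vs. splits_at_slot (snd x) c us vs \<and> c' = us @ replacement (fst x) j @ vs)"
  by (auto simp: insertion_def splits_at_slot_def)

lemma insertionE:
  assumes "insertion j x c c'"
  obtains us vs where "c = us @ Slot # vs" "c' = us @ replacement (fst x) j @ vs"
  using assms by (auto simp: insertion_def)

lemma ex_insertion_iff: "(\<exists>c'. insertion j x c c') \<longleftrightarrow> snd x \<in> {1..count_list c Slot}"
  using ex_splits_at_slot_iff[of "snd x" c] by (auto simp: insertion_iff_splits_at_slot)

lemma insertion_unique: "insertion j x c c' \<Longrightarrow> insertion j x c c'' \<Longrightarrow> c' = c''"
  unfolding insertion_iff_splits_at_slot using splits_at_slot_unique by blast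

lemma set_entries_insertion:
  "insertion j x c c' \<Longrightarrow> set (entries c') = insert j (set (entries c))"
  by (auto elim!: insertionE)

lemma builds_snocE:
  assumes "builds (w @ [x]) c'"
  obtains c where "builds w c" "insertion (length w + 1) x c c'"
  using assms by (cases rule: builds.cases) auto

lemma builds_unique: "builds w c \<Longrightarrow> builds w d \<Longrightarrow> c = d"
proof (induction arbitrary: d rule: builds.induct)
  case start
  then show ?case by (auto elim: builds.cases)
next
  case (step w c x c')
  from step.prems obtain e where "builds w e" "insertion (length w + 1) x e d"
    by (rule builds_snocE)
  with step.IH step.hyps(2) show ?case using insertion_unique by blast
qed

lemma set_entries_builds: "builds w c \<Longrightarrow> set (entries c) = {1..length w}"
  by (induction rule: builds.induct)
    (simp_all add: set_entries_insertion atLeastAtMostSuc_conv)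

lemma distinct_entries_builds: "builds w c \<Longrightarrow> distinct (entries c)"
proof (induction rule: builds.induct)
  case (step w c x c')
  then have "Suc (length w) \<notin> set (entries c)" by (simp add: set_entries_builds)
  with step.IH step.hyps(2) show ?case by (auto elim!: insertionE)
qed simp

lemma encodings_Av_iff:
  "w \<in> encodings (Av k P) \<longleftrightarrow> (\<exists>\<pi>. builds w (map Entry \<pi>) \<and> \<not> contains_pop k P \<pi>)"
proof -
  have "\<pi> \<in> permutations_of_set {1..length w}" if "builds w (map Entry \<pi>)" for \<pi>
    using set_entries_builds[OF that] distinct_entries_builds[OF that]
    by (auto intro: permutations_of_setI)
  then show ?thesis by (auto simp: encodings_def encodes_def Av_def)
qed


section \<open>Bipartite patterns bound the number of slots\<close>

definition slots_bounded :: "nat \<Rightarrow> letter list \<Rightarrow> bool" where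
  "slots_bounded m w \<longleftrightarrow> (\<forall>u c. prefix u w \<and> builds u c \<longrightarrow> count_list c Slot \<le> m)"

lemma builds_no_adjacent_Slots:
  "builds w c \<Longrightarrow> successively (\<lambda>s t. \<not> (s = Slot \<and> t = Slot)) c"
proof (induction rule: builds.induct)
  case (step w c x c')
  from step.hyps(2) obtain us vs where
    "c = us @ Slot # vs" "c' = us @ replacement (fst x) (length w + 1) @ vs"
    by (rule insertionE)
  with step.IH show ?case
    by (cases "fst x") (auto simp: successively_append_iff successively_Cons)
qed simp

fun exceeds :: "nat \<Rightarrow> symbol \<Rightarrow> bool" where
  "exceeds j Slot \<longleftrightarrow> True"
| "exceeds j (Entry v) \<longleftrightarrow> j < v"

lemma insertion_subseq_exceeds:
  assumes "insertion i x c c'" "j < i"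
  shows "subseq (map (exceeds j) c) (map (exceeds j) c')"
proof -
  from assms(1) obtain us vs where c: "c = us @ Slot # vs" "c' = us @ replacement (fst x) i @ vs"
    by (rule insertionE)
  have "subseq [True] (map (exceeds j) (replacement (fst x) i))"
    using assms(2) by (cases "fst x") auto
  then have "subseq (map (exceeds j) us @ [True] @ map (exceeds j) vs)
      (map (exceeds j) us @ map (exceeds j) (replacement (fst x) i) @ map (exceeds j) vs)"
    by (intro list_emb_append_mono subseq_order.order_refl)
  with c show ?thesis by simp
qed

lemma builds_subseq_exceeds:
  assumes "builds w c" "builds (w @ u) d"
  shows "subseq (map (exceeds (length w)) c) (map (exceeds (length w)) d)"
  using assms(2)
proof (induction u arbitrary: d rule: rev_induct)
  case Nil
  then show ?case using builds_unique[OF assms(1)] by auto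
next
  case (snoc x u)
  then have "builds ((w @ u) @ [x]) d" by simp
  then obtain e where "builds (w @ u) e" "insertion (length (w @ u) + 1) x e d"
    by (rule builds_snocE)
  with snoc.IH insertion_subseq_exceeds[of _ x e d "length w"] show ?case
    by (force intro: subseq_order.order_trans)
qed

lemma subseq_Slots_large_entries:
  assumes "builds w c" "builds (w @ u) (map Entry \<pi>)"
  shows "subseq (map (\<lambda>s. s = Slot) c) (map (\<lambda>v. length w < v) \<pi>)"
proof -
  have "exceeds (length w) s \<longleftrightarrow> s = Slot" if "s \<in> set c" for s
    using that set_subset_Slot_entries[of c] set_entries_builds[OF assms(1)] by (cases s) auto
  then have "map (exceeds (length w)) c = map (\<lambda>s. s = Slot) c" by simp
  with builds_subseq_exceeds[OF assms] show ?thesis by (simp add: comp_def)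
qed

theorem slots_bounded_encodings_bipartite:
  assumes "partial_order_on {1..k} P" "bipartite_pop P" "w \<in> encodings (Av k P)"
  shows "slots_bounded k w"
  unfolding slots_bounded_def
proof (intro allI impI, elim conjE)
  fix u c assume "prefix u w" and c: "builds u c"
  from assms(3) obtain \<pi> where \<pi>: "builds w (map Entry \<pi>)" "\<not> contains_pop k P \<pi>"
    unfolding encodings_Av_iff by blast
  from \<open>prefix u w\<close> obtain u' where w: "w = u @ u'" by (auto simp: prefix_def)
  show "count_list c Slot \<le> k"
  proof (rule ccontr)
    assume many_slots: "\<not> count_list c Slot \<le> k"
    have count: "count_list (map (\<lambda>s. s = Slot) c) True = count_list c Slot"
      by (induction c) auto
    let ?xs = "map (\<lambda>b. predecessors P b \<noteq> {}) [1..<Suc k]"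
    have "subseq ?xs (concat (replicate k [True, False]))"
      using subseq_concat_replicate[of ?xs "[True, False]"] by (auto simp del: upt_Suc)
    also have "subseq \<dots> (map (\<lambda>s. s = Slot) c)"
      using builds_no_adjacent_Slots[OF c] many_slots count
      by (intro subseq_alternating_if_no_adjacent_True) (simp_all add: successively_map)
    also have "subseq \<dots> (map (\<lambda>v. length u < v) \<pi>)"
      using subseq_Slots_large_entries[OF c] \<pi>(1) w by blast
    finally show False
      using contains_pop_if_subseq_threshold[OF assms(1,2)] \<pi>(2) by blast
  qed
qed


section \<open>Interleavings of pattern elements and slots\<close>

text \<open>
  The map \<open>g\<close> assigns elements of the pattern to values; in a projected configuration \<open>Entry a\<close>
  stands for the element \<open>a\<close> of the pattern instead of a value.
\<close>

fun project :: "(nat \<rightharpoonup> nat) \<Rightarrow> symbol list \<Rightarrow> symbol list" where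
  "project g [] = []"
| "project g (Slot # c) = Slot # project g c"
| "project g (Entry v # c) =
     (case g v of None \<Rightarrow> project g c | Some a \<Rightarrow> Entry a # project g c)"

lemma project_append [simp]: "project g (c @ d) = project g c @ project g d"
  by (induction g c rule: project.induct) (auto split: option.splits)

lemma count_Slot_project [simp]: "count_list (project g c) Slot = count_list c Slot"
  by (induction g c rule: project.induct) (auto split: option.splits)

lemma entries_project: "entries (project g c) = List.map_filter g (entries c)"
  by (induction g c rule: project.induct) (auto split: option.splits)

lemma set_entries_project:
  "dom g \<subseteq> set (entries c) \<Longrightarrow> set (entries (project g c)) = ran g"
  by (force simp: entries_project List.map_filter_def ran_def dom_def)

lemma project_map_Entry: "project g (map Entry \<pi>) = map Entry (List.map_filter g \<pi>)"
  by (induction \<pi>) (auto split: option.splits)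

lemma project_fun_upd_None: "j \<notin> set (entries c) \<Longrightarrow> project (g(j := None)) c = project g c"
  by (induction g c rule: project.induct) (auto split: option.splits)

lemma project_replacement: "project g (replacement op j) = project (\<lambda>_. g j) (replacement op 0)"
  by (cases op) (auto split: option.splits)

lemma project_append_replacement:
  assumes "j \<notin> set (entries us)" "j \<notin> set (entries vs)"
  shows "project g (us @ replacement op j @ vs) =
    project (g(j := None)) us @ project (\<lambda>_. g j) (replacement op 0) @ project (g(j := None)) vs"
  using assms project_replacement[of g] by (simp add: project_fun_upd_None)

lemma splits_at_slot_project:
  "splits_at_slot i c us vs \<Longrightarrow> splits_at_slot i (project g c) (project g us) (project g vs)"
  by (simp add: splits_at_slot_def)

text \<open>
  Beside closure under predecessors, this says that \<open>g\<close> respects the order: the predecessors of a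
  placed element sit at smaller values.
\<close>

definition down_closed_labelling :: "nat rel \<Rightarrow> nat set \<Rightarrow> (nat \<rightharpoonup> nat) \<Rightarrow> bool" where
  "down_closed_labelling P V g \<longleftrightarrow>
     dom g \<subseteq> V \<and> (\<forall>v b. g v = Some b \<longrightarrow> predecessors P b \<subseteq> ran (g |` {..<v}))"

definition interleavings :: "nat rel \<Rightarrow> symbol list \<Rightarrow> symbol list set" where
  "interleavings P c = {project g c | g. down_closed_labelling P (set (entries c)) g}"

text \<open>
  The new value plays \<open>b\<close> if \<open>y = Some b\<close>, and the embedding does not use it if \<open>y = None\<close>.
\<close>

definition interleaving_step :: "nat rel \<Rightarrow> letter \<Rightarrow> symbol list \<Rightarrow> symbol list \<Rightarrow> bool" where
  "interleaving_step P x t t' \<longleftrightarrow>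
     (\<exists>us vs y. splits_at_slot (snd x) t us vs \<and>
        t' = us @ project (\<lambda>_. y) (replacement (fst x) 0) @ vs \<and>
        (\<forall>b. y = Some b \<longrightarrow> predecessors P b \<subseteq> set (entries t)))"

lemma down_closed_labelling_insert_iff:
  assumes "\<forall>v\<in>V. v < j"
  shows "down_closed_labelling P (insert j V) g \<longleftrightarrow>
    down_closed_labelling P V (g(j := None)) \<and>
    (\<forall>b. g j = Some b \<longrightarrow> predecessors P b \<subseteq> ran (g(j := None)))"
proof (cases "dom g \<subseteq> insert j V")
  case True
  have le: "v \<le> j" if "g v = Some b" for v b
  proof -
    have "v \<in> insert j V" using True that by blast
    then show ?thesis using assms by auto
  qed
  let ?h = "g(j := None)"
  have below: "g |` {..<v} = ?h |` {..<v}" if "?h v = Some b" for v b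
    using that le[of v] by (auto simp: restrict_map_def fun_eq_iff split: if_splits)
  have below_j: "g |` {..<j} = ?h"
  proof
    show "(g |` {..<j}) v = ?h v" for v
      using le[of v] by (cases "g v") (auto simp: restrict_map_def)
  qed
  have "(\<forall>v b. g v = Some b \<longrightarrow> predecessors P b \<subseteq> ran (g |` {..<v})) \<longleftrightarrow>
      (\<forall>v b. ?h v = Some b \<longrightarrow> predecessors P b \<subseteq> ran (g |` {..<v})) \<and>
      (\<forall>b. g j = Some b \<longrightarrow> predecessors P b \<subseteq> ran (g |` {..<j}))"
    by (metis fun_upd_apply option.distinct(1))
  moreover have "dom ?h \<subseteq> V" using True by auto
  ultimately show ?thesis
    using True below unfolding down_closed_labelling_def below_j by (metis (no_types, lifting))
next
  case False
  then show ?thesis by (auto simp: down_closed_labelling_def)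
qed

lemma interleaving_step_project_restrict:
  assumes ins: "insertion j x c c'" and less: "\<forall>v\<in>set (entries c). v < j"
    and g: "down_closed_labelling P (set (entries c')) g"
  shows "down_closed_labelling P (set (entries c)) (g(j := None))"
    and "interleaving_step P x (project (g(j := None)) c) (project g c')"
proof -
  let ?h = "g(j := None)"
  have h: "down_closed_labelling P (set (entries c)) ?h"
    and preds: "\<forall>b. g j = Some b \<longrightarrow> predecessors P b \<subseteq> ran ?h"
    using g set_entries_insertion[OF ins] down_closed_labelling_insert_iff[OF less] by auto
  from h show "down_closed_labelling P (set (entries c)) ?h" .
  from ins obtain us vs where split: "splits_at_slot (snd x) c us vs"
    and c': "c' = us @ replacement (fst x) j @ vs"
    by (auto simp: insertion_iff_splits_at_slot)
  have "j \<notin> set (entries us)" "j \<notin> set (entries vs)"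
    using split less by (auto simp: splits_at_slot_def)
  then have "project g c' =
      project ?h us @ project (\<lambda>_. g j) (replacement (fst x) 0) @ project ?h vs"
    unfolding c' by (rule project_append_replacement)
  moreover have "set (entries (project ?h c)) = ran ?h"
    using h by (intro set_entries_project) (simp add: down_closed_labelling_def)
  ultimately show "interleaving_step P x (project ?h c) (project g c')"
    unfolding interleaving_step_def using preds splits_at_slot_project[OF split] by blast
qed

lemma interleaving_step_project_in_interleavings:
  assumes ins: "insertion j x c c'" and less: "\<forall>v\<in>set (entries c). v < j"
    and g: "down_closed_labelling P (set (entries c)) g"
    and step: "interleaving_step P x (project g c) t'"
  shows "t' \<in> interleavings P c'"
proof -
  from step obtain us' vs' y where split': "splits_at_slot (snd x) (project g c) us' vs'"
    and t': "t' = us' @ project (\<lambda>_. y) (replacement (fst x) 0) @ vs'"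
    and y: "\<forall>b. y = Some b \<longrightarrow> predecessors P b \<subseteq> set (entries (project g c))"
    unfolding interleaving_step_def by blast
  from ins obtain us vs where split: "splits_at_slot (snd x) c us vs"
    and c': "c' = us @ replacement (fst x) j @ vs"
    by (auto simp: insertion_iff_splits_at_slot)
  have us'_vs': "us' = project g us \<and> vs' = project g vs"
    using splits_at_slot_unique[OF split' splits_at_slot_project[OF split]] .
  have dom: "dom g \<subseteq> set (entries c)" using g by (simp add: down_closed_labelling_def)
  then have "g j = None" using less by blast
  then have g_upd: "g(j := y, j := None) = g" by auto
  have "j \<notin> set (entries us)" "j \<notin> set (entries vs)"
    using split less by (auto simp: splits_at_slot_def)
  then have "project (g(j := y)) c' = t'"
    unfolding c' using project_append_replacement[of j us vs "g(j := y)"] us'_vs' t' g_upd by simp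
  moreover have "down_closed_labelling P (set (entries c')) (g(j := y))"
    unfolding set_entries_insertion[OF ins] down_closed_labelling_insert_iff[OF less] g_upd
    using g y set_entries_project[OF dom] by simp
  ultimately show ?thesis unfolding interleavings_def by blast
qed

lemma interleavings_insertion:
  assumes "insertion j x c c'" "\<forall>v\<in>set (entries c). v < j"
  shows "interleavings P c' = {t'. \<exists>t\<in>interleavings P c. interleaving_step P x t t'}"
proof (intro equalityI subsetI)
  fix t' assume "t' \<in> interleavings P c'"
  then obtain g where "t' = project g c'" "down_closed_labelling P (set (entries c')) g"
    by (auto simp: interleavings_def)
  with interleaving_step_project_restrict[OF assms]
  show "t' \<in> {t'. \<exists>t\<in>interleavings P c. interleaving_step P x t t'}"
    unfolding interleavings_def by blast
next
  fix t' assume "t' \<in> {t'. \<exists>t\<in>interleavings P c. interleaving_step P x t t'}"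
  with interleaving_step_project_in_interleavings[OF assms] show "t' \<in> interleavings P c'"
    unfolding interleavings_def by blast
qed

lemma Nil_in_interleavings_iff: "[] \<in> interleavings P c \<longleftrightarrow> Slot \<notin> set c"
proof
  assume "[] \<in> interleavings P c"
  then obtain g where "[] = project g c" by (auto simp: interleavings_def)
  then show "Slot \<notin> set c"
    using count_Slot_project[of g c] by (auto simp: count_list_0_iff)
next
  assume "Slot \<notin> set c"
  then obtain \<pi> where "c = map Entry \<pi>" by (auto simp: Slot_notin_set_iff)
  then have "[] = project Map.empty c"
    by (simp add: project_map_Entry List.map_filter_def)
  moreover have "down_closed_labelling P (set (entries c)) Map.empty"
    by (simp add: down_closed_labelling_def)
  ultimately show "[] \<in> interleavings P c" unfolding interleavings_def by blast
qed

lemma pop_instance_filter_labelled: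
  assumes "down_closed_labelling P (set \<pi>) g" "List.map_filter g \<pi> = [1..<Suc k]"
  shows "pop_instance k P (filter (\<lambda>v. g v \<noteq> None) \<pi>)"
proof -
  define \<sigma> where "\<sigma> = filter (\<lambda>v. g v \<noteq> None) \<pi>"
  have labels: "map (the \<circ> g) \<sigma> = [1..<Suc k]"
    using assms(2) by (simp add: List.map_filter_def \<sigma>_def)
  have len: "length \<sigma> = k" using arg_cong[OF labels, of length] by (simp del: upt_Suc)
  have label: "the (g (\<sigma> ! i)) = Suc i" if "i < k" for i
    using arg_cong[OF labels, of "\<lambda>xs. xs ! i"] that len by (simp del: upt_Suc)
  have label_iff: "g v = Some a \<longleftrightarrow> a \<in> {1..k} \<and> v = \<sigma> ! (a - 1)" for v a
  proof
    assume "g v = Some a"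
    moreover from this have "v \<in> set \<sigma>"
      using assms(1) by (auto simp: \<sigma>_def down_closed_labelling_def)
    then obtain i where "i < k" "v = \<sigma> ! i" using len by (auto simp: in_set_conv_nth)
    ultimately show "a \<in> {1..k} \<and> v = \<sigma> ! (a - 1)" using label[of i] by simp
  next
    assume a: "a \<in> {1..k} \<and> v = \<sigma> ! (a - 1)"
    then have "v \<in> set \<sigma>" using len by auto
    then show "g v = Some a" using a label[of "a - 1"] by (auto simp: \<sigma>_def)
  qed
  have "\<sigma> ! (a - 1) < \<sigma> ! (b - 1)" if "b \<in> {1..k}" "a \<in> predecessors P b" for a b
  proof -
    have "a \<in> ran (g |` {..<\<sigma> ! (b - 1)})"
      using assms(1) that label_iff[of _ b] unfolding down_closed_labelling_def by blast
    then show ?thesis by (auto simp: ran_def restrict_map_def label_iff split: if_splits)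
  qed
  with len show ?thesis by (simp add: pop_instance_def \<sigma>_def)
qed

lemma down_closed_labelling_pop_instance:
  assumes "P \<subseteq> {1..k} \<times> {1..k}" "distinct \<sigma>" "set \<sigma> \<subseteq> V" "pop_instance k P \<sigma>"
  shows "down_closed_labelling P V (map_of (zip \<sigma> [1..<Suc k]))"
proof -
  let ?g = "map_of (zip \<sigma> [1..<Suc k])"
  have len: "length \<sigma> = k" using assms(4) by (simp add: pop_instance_def)
  have label_iff: "?g v = Some a \<longleftrightarrow> a \<in> {1..k} \<and> v = \<sigma> ! (a - 1)" for v a
  proof -
    have "?g v = Some a \<longleftrightarrow> (v, a) \<in> set (zip \<sigma> [1..<Suc k])"
      using len assms(2) by (intro map_of_eq_Some_iff) (simp del: upt_Suc)
    also have "\<dots> \<longleftrightarrow> (\<exists>i<k. v = \<sigma> ! i \<and> a = Suc i)"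
      using len by (auto simp: in_set_zip simp del: upt_Suc)
    also have "\<dots> \<longleftrightarrow> a \<in> {1..k} \<and> v = \<sigma> ! (a - 1)"
      by (cases a) (auto simp: Suc_le_eq)
    finally show ?thesis .
  qed
  have "dom ?g \<subseteq> V" using assms(3) len by (simp del: upt_Suc)
  moreover have "predecessors P b \<subseteq> ran (?g |` {..<v})" if "?g v = Some b" for v b
  proof
    fix a assume a: "a \<in> predecessors P b"
    then have "a \<in> {1..k}" using assms(1) by (auto simp: predecessors_def)
    then have "?g (\<sigma> ! (a - 1)) = Some a" "\<sigma> ! (a - 1) < v"
      using a that assms(4) unfolding label_iff pop_instance_def by blast+
    then show "a \<in> ran (?g |` {..<v})" by (auto intro!: ranI simp: restrict_map_def)
  qed
  ultimately show ?thesis by (simp add: down_closed_labelling_def)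
qed

lemma full_interleaving_iff_contains_pop:
  assumes "P \<subseteq> {1..k} \<times> {1..k}" "distinct \<pi>"
  shows "map Entry [1..<Suc k] \<in> interleavings P (map Entry \<pi>) \<longleftrightarrow> contains_pop k P \<pi>"
proof
  assume "map Entry [1..<Suc k] \<in> interleavings P (map Entry \<pi>)"
  then obtain g where g: "down_closed_labelling P (set \<pi>) g"
    and "map Entry [1..<Suc k] = map Entry (List.map_filter g \<pi>)"
    unfolding interleavings_def project_map_Entry entries_map_Entry by blast
  then have "List.map_filter g \<pi> = [1..<Suc k]" by (metis entries_map_Entry)
  then show "contains_pop k P \<pi>"
    using contains_pop_if_subseq[OF subseq_filter_left pop_instance_filter_labelled[OF g]] by blast
next
  assume "contains_pop k P \<pi>"
  then obtain \<sigma> where \<sigma>: "subseq \<sigma> \<pi>" "pop_instance k P \<sigma>"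
    using contains_pop_imp_subseq by blast
  let ?g = "map_of (zip \<sigma> [1..<Suc k])"
  have "distinct \<sigma>" "set \<sigma> \<subseteq> set \<pi>"
    using \<sigma>(1) assms(2) set_nths_subset by (force simp: subseq_conv_nths)+
  then have "down_closed_labelling P (set \<pi>) ?g"
    using down_closed_labelling_pop_instance[OF assms(1)] \<sigma>(2) by blast
  moreover have "List.map_filter ?g \<pi> = [1..<Suc k]"
    using \<sigma>(2)
    by (intro map_filter_map_of_zip[OF \<sigma>(1) assms(2)]) (simp add: pop_instance_def del: upt_Suc)
  ultimately show "map Entry [1..<Suc k] \<in> interleavings P (map Entry \<pi>)"
    unfolding interleavings_def project_map_Entry entries_map_Entry
    by (intro CollectI exI[of _ ?g]) (simp del: upt_Suc)
qed


section \<open>The automaton\<close>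

definition bounded_interleavings :: "nat \<Rightarrow> nat \<Rightarrow> symbol list set" where
  "bounded_interleavings k m = {t. subseq (entries t) [1..<Suc k] \<and> count_list t Slot \<le> m}"

definition insertion_state :: "nat \<Rightarrow> nat \<Rightarrow> nat rel \<Rightarrow> letter list \<Rightarrow> symbol list set" where
  "insertion_state k m P w =
     {t \<in> bounded_interleavings k m. slots_bounded m w \<and> (\<exists>c. builds w c \<and> t \<in> interleavings P c)}"

definition advance :: "nat \<Rightarrow> nat \<Rightarrow> nat rel \<Rightarrow> symbol list set \<Rightarrow> letter \<Rightarrow> symbol list set" where
  "advance k m P S x = {t' \<in> bounded_interleavings k m. \<exists>t\<in>S. interleaving_step P x t t'}"

lemma finite_bounded_interleavings: "finite (bounded_interleavings k m)"
proof (rule finite_subset)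
  show "bounded_interleavings k m \<subseteq>
      {t. set t \<subseteq> insert Slot (Entry ` {1..k}) \<and> length t \<le> m + k}"
  proof (rule subsetI, intro CollectI conjI)
    fix t assume t: "t \<in> bounded_interleavings k m"
    then have sub: "subseq (entries t) [1..<Suc k]" by (simp add: bounded_interleavings_def)
    have "set (entries t) \<subseteq> {1..k}"
      using sub by (auto elim!: list_emb_set simp: less_Suc_eq_le simp del: upt_Suc)
    then show "set t \<subseteq> insert Slot (Entry ` {1..k})" using set_subset_Slot_entries[of t] by blast
    show "length t \<le> m + k"
      using list_emb_length[OF sub] t length_eq_count_Slot_entries[of t]
      by (simp add: bounded_interleavings_def del: upt_Suc)
  qed
qed (simp add: finite_lists_length_le)

lemma count_Slot_interleavings:
  "t \<in> interleavings P c \<Longrightarrow> count_list t Slot = count_list c Slot"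
  by (auto simp: interleavings_def)

lemma interleaving_step_subseq_entries:
  "interleaving_step P x t t' \<Longrightarrow> subseq (entries t) (entries t')"
  by (auto simp: interleaving_step_def splits_at_slot_def intro!: list_emb_append_mono)

lemma slots_bounded_snoc:
  "slots_bounded m (w @ [x]) \<longleftrightarrow>
     slots_bounded m w \<and> (\<forall>c. builds (w @ [x]) c \<longrightarrow> count_list c Slot \<le> m)"
  by (auto simp: slots_bounded_def)

lemma insertion_state_snoc:
  "insertion_state k m P (w @ [x]) = advance k m P (insertion_state k m P w) x"
proof (intro equalityI subsetI)
  fix t' assume "t' \<in> insertion_state k m P (w @ [x])"
  then obtain c' where t': "t' \<in> bounded_interleavings k m" "t' \<in> interleavings P c'"
    and bounded: "slots_bounded m w" and "builds (w @ [x]) c'"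
    by (auto simp: insertion_state_def slots_bounded_snoc)
  then obtain c where c: "builds w c" "insertion (length w + 1) x c c'" by (blast elim: builds_snocE)
  then obtain t where t: "t \<in> interleavings P c" "interleaving_step P x t t'"
    using t'(2) interleavings_insertion[OF c(2)] set_entries_builds[OF c(1)] by auto
  have "count_list t Slot \<le> m"
    using bounded c(1) by (auto simp: count_Slot_interleavings[OF t(1)] slots_bounded_def)
  then have "t \<in> bounded_interleavings k m"
    using t'(1) interleaving_step_subseq_entries[OF t(2)]
    by (auto simp: bounded_interleavings_def intro: subseq_order.order_trans)
  with t t'(1) c(1) bounded show "t' \<in> advance k m P (insertion_state k m P w) x"
    by (auto simp: advance_def insertion_state_def)
next
  fix t' assume "t' \<in> advance k m P (insertion_state k m P w) x"
  then obtain t c where t': "t' \<in> bounded_interleavings k m" "interleaving_step P x t t'"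
    and t: "t \<in> interleavings P c" and c: "builds w c" and bounded: "slots_bounded m w"
    by (auto simp: advance_def insertion_state_def)
  have "snd x \<in> {1..count_list c Slot}"
    using t'(2) ex_splits_at_slot_iff[of "snd x" t] count_Slot_interleavings[OF t]
    by (auto simp: interleaving_step_def)
  then obtain c' where c': "insertion (length w + 1) x c c'" using ex_insertion_iff by blast
  then have builds: "builds (w @ [x]) c'" by (rule builds.step[OF c])
  have t'_in: "t' \<in> interleavings P c'"
    using t t'(2) interleavings_insertion[OF c'] set_entries_builds[OF c] by auto
  have "count_list c' Slot \<le> m"
    using t'(1) count_Slot_interleavings[OF t'_in] by (simp add: bounded_interleavings_def)
  then have "slots_bounded m (w @ [x])"
    using bounded builds_unique[OF builds] by (auto simp: slots_bounded_snoc)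
  with t'(1) t'_in builds show "t' \<in> insertion_state k m P (w @ [x])"
    by (auto simp: insertion_state_def)
qed

lemma builds_in_lists:
  "builds w c \<Longrightarrow> slots_bounded m w \<Longrightarrow> w \<in> lists (UNIV \<times> {1..m})"
proof (induction rule: builds.induct)
  case (step w c x c')
  have "snd x \<in> {1..count_list c Slot}" using step.hyps(2) ex_insertion_iff by blast
  moreover have "count_list c Slot \<le> m" using step by (auto simp: slots_bounded_def)
  ultimately show ?case using step by (cases x) (auto simp: slots_bounded_snoc)
qed simp

lemma encodings_Av_iff_insertion_state:
  assumes "P \<subseteq> {1..k} \<times> {1..k}" "\<And>w. w \<in> encodings (Av k P) \<Longrightarrow> slots_bounded m w"
  shows "w \<in> encodings (Av k P) \<longleftrightarrow>
    [] \<in> insertion_state k m P w \<and> map Entry [1..<Suc k] \<notin> insertion_state k m P w"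
proof -
  have Nil_iff: "[] \<in> insertion_state k m P w \<longleftrightarrow>
      slots_bounded m w \<and> (\<exists>\<pi>. builds w (map Entry \<pi>))"
    by (auto simp: insertion_state_def bounded_interleavings_def Nil_in_interleavings_iff
        Slot_notin_set_iff)
  have full_iff: "map Entry [1..<Suc k] \<in> insertion_state k m P w \<longleftrightarrow> contains_pop k P \<pi>"
    if \<pi>: "builds w (map Entry \<pi>)" and bounded: "slots_bounded m w" for \<pi>
  proof -
    have "Slot \<notin> set (map Entry [1..<Suc k])" by auto
    then have "map Entry [1..<Suc k] \<in> bounded_interleavings k m"
      by (simp add: bounded_interleavings_def del: upt_Suc)
    moreover have "c = map Entry \<pi>" if "builds w c" for c
      using builds_unique[OF that \<pi>] .
    ultimately have "map Entry [1..<Suc k] \<in> insertion_state k m P w \<longleftrightarrow>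
        map Entry [1..<Suc k] \<in> interleavings P (map Entry \<pi>)"
      using \<pi> bounded unfolding insertion_state_def by blast
    also have "\<dots> \<longleftrightarrow> contains_pop k P \<pi>"
      using full_interleaving_iff_contains_pop[OF assms(1)] distinct_entries_builds[OF \<pi>] by simp
    finally show ?thesis .
  qed
  show ?thesis
    using assms(2)[of w] Nil_iff full_iff unfolding encodings_Av_iff by blast
qed

instance operation :: finite
proof
  have "(UNIV :: operation set) = {Fill, Leftmost, Rightmost, Middle}"
    using operation.exhaust by auto
  then show "finite (UNIV :: operation set)" by (metis finite.emptyI finite.insertI)
qed

theorem has_regular_insertion_encoding_Av_if_slots_bounded:
  assumes "P \<subseteq> {1..k} \<times> {1..k}" "\<And>w. w \<in> encodings (Av k P) \<Longrightarrow> slots_bounded m w"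
  shows "has_regular_insertion_encoding (Av k P)"
proof -
  let ?\<Sigma> = "UNIV \<times> {1..m} :: letter set"
  let ?F = "{S. [] \<in> S \<and> map Entry [1..<Suc k] \<notin> S}"
  have "insertion_state k m P ` lists ?\<Sigma> \<subseteq> Pow (bounded_interleavings k m)"
    by (auto simp: insertion_state_def)
  then have "finite (insertion_state k m P ` lists ?\<Sigma>)"
    using finite_bounded_interleavings finite_subset by blast
  then have "regular_language ?\<Sigma> {w \<in> lists ?\<Sigma>. insertion_state k m P w \<in> ?F}"
    by (rule regular_language_state_map) (rule insertion_state_snoc)
  moreover have "w \<in> lists ?\<Sigma>" if "w \<in> encodings (Av k P)" for w
    using that assms(2)[OF that] builds_in_lists unfolding encodings_Av_iff by blast
  then have "encodings (Av k P) = {w \<in> lists ?\<Sigma>. insertion_state k m P w \<in> ?F}"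
    using encodings_Av_iff_insertion_state[OF assms] by blast
  ultimately show ?thesis
    unfolding has_regular_insertion_encoding_def by (intro exI[of _ ?\<Sigma>]) simp
qed

theorem theorem5:
  fixes k :: nat and P :: "nat rel"
  assumes "partial_order_on {1..k} P"
    and "bipartite_pop P"
  shows "has_regular_insertion_encoding (Av k P)"
proof (rule has_regular_insertion_encoding_Av_if_slots_bounded)
  show "P \<subseteq> {1..k} \<times> {1..k}"
    using assms(1) by (simp add: order_on_defs)
  show "slots_bounded k w" if "w \<in> encodings (Av k P)" for w
    using assms that by (rule slots_bounded_encodings_bipartite)
qed

end
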